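(* Let $\mathbb{K}$ be $\mathbb{R}$ or $\mathbb{C}$, and let $X$ be a topological exponential vector space over $\mathbb{K}$. Then every compact subset of $X$ is bounded.
   Context: An exponential vector space (evs) over a field $K$ is a partially ordered set $(X,\leq)$ with a binary operation $+$ on $X$ and a scalar multiplication $\cdot:K\times X\to X$ such that for all $x,y,z\in X$, $\alpha,\beta\in K$: ($A_1$) $(X,+)$ is a commutative semigroup with identity $\theta$; ($A_2$) $x\leq y$ implies $x+z\leq y+z$ and $\alpha\cdot x\leq\alpha\cdot y$; ($A_3$) $\alpha\cdot(x+y)=\alpha\cdot x+\alpha\cdot y$, $\alpha\cdot(\beta\cdot x)=(\alpha\beta)\cdot x$, $(\alpha+\beta)\cdot x\leq\alpha\cdot x+\beta\cdot x$, $1\cdot x=x$; ($A_4$) $\alpha\cdot x=\theta$ iff $\alpha=0$ or $x=\theta$; ($A_5$) $x+(-1)\cdot x=\theta$ iff $x\in X_0:=\{z\in X: y\nleq z\ \forall y\in X\smallsetminus\{z\}\}$ (the set of minimal elements); ($A_6$) for each $x\in X$ there is $p\in X_0$ with $p\leq x$. A topological evs over $\mathbb{K}$ ($=\mathbb{R}$ or $\mathbb{C}$, usual topology) is an evs $X$ over $\mathbb{K}$ with a topology such that addition $X\times X\to X$ and scalar multiplication $\mathbb{K}\times X\to X$ are continuous and the partial order is closed, i.e. $\{(x,y)\in X\times X:x\leq y\}$ is closed in $X\times X$. A subset $A$ of a topological evs $X$ is bounded if for every neighbourhood $V$ of $\theta$ there is a real $\alpha>0$ such that $\mu A:=\{\mu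 a:a\in A\}\subseteq V$ for all $\mu\in\mathbb{K}$ with $|\mu|\leq\alpha$. Neighbourhoods need not be open. *)

theory Defs
  imports "HOL-Analysis.Analysis"
begin

definition minimal_elements :: "'a set \<Rightarrow> ('a \<Rightarrow> 'a \<Rightarrow> bool) \<Rightarrow> 'a set" where
  "minimal_elements X le = {z \<in> X. \<forall>y \<in> X - {z}. \<not> le y z}"

locale evs =
  fixes X :: "'a set"
    and add :: "'a \<Rightarrow> 'a \<Rightarrow> 'a"  (infixl \<open>\<oplus>\<close> 65)
    and smul :: "'k::field \<Rightarrow> 'a \<Rightarrow> 'a"  (infixr \<open>\<odot>\<close> 75)
    and le :: "'a \<Rightarrow> 'a \<Rightarrow> bool"  (infix \<open>\<preceq>\<close> 50)
    and theta :: 'a  (\<open>\<theta>\<close>)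
  assumes le_refl: "reflp_on X (\<preceq>)"
    and le_antisym: "antisymp_on X (\<preceq>)"
    and le_trans: "transp_on X (\<preceq>)"
    and add_closed: "\<lbrakk>x \<in> X; y \<in> X\<rbrakk> \<Longrightarrow> x \<oplus> y \<in> X"
    and smul_closed: "x \<in> X \<Longrightarrow> \<alpha> \<odot> x \<in> X"
    and theta_closed: "\<theta> \<in> X"
    and add_assoc: "\<lbrakk>x \<in> X; y \<in> X; z \<in> X\<rbrakk> \<Longrightarrow> (x \<oplus> y) \<oplus> z = x \<oplus> (y \<oplus> z)"
    and add_commute: "\<lbrakk>x \<in> X; y \<in> X\<rbrakk> \<Longrightarrow> x \<oplus> y = y \<oplus> x"
    and add_theta: "x \<in> X \<Longrightarrow> x \<oplus> \<theta> = x"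
    and add_mono: "\<lbrakk>x \<in> X; y \<in> X; z \<in> X; x \<preceq> y\<rbrakk> \<Longrightarrow> x \<oplus> z \<preceq> y \<oplus> z"
    and smul_mono: "\<lbrakk>x \<in> X; y \<in> X; x \<preceq> y\<rbrakk> \<Longrightarrow> \<alpha> \<odot> x \<preceq> \<alpha> \<odot> y"
    and smul_add: "\<lbrakk>x \<in> X; y \<in> X\<rbrakk> \<Longrightarrow> \<alpha> \<odot> (x \<oplus> y) = \<alpha> \<odot> x \<oplus> \<alpha> \<odot> y"
    and smul_smul: "x \<in> X \<Longrightarrow> \<alpha> \<odot> (\<beta> \<odot> x) = (\<alpha> * \<beta>) \<odot> x"
    and add_smul_le: "x \<in> X \<Longrightarrow> (\<alpha> + \<beta>) \<odot> x \<preceq> \<alpha> \<odot> x \<oplus> \<beta> \<odot> x"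
    and one_smul: "x \<in> X \<Longrightarrow> 1 \<odot> x = x"
    and smul_eq_theta_iff: "x \<in> X \<Longrightarrow> \<alpha> \<odot> x = \<theta> \<longleftrightarrow> \<alpha> = 0 \<or> x = \<theta>"
    and add_neg_eq_theta_iff:
      "x \<in> X \<Longrightarrow> x \<oplus> (- 1) \<odot> x = \<theta> \<longleftrightarrow> x \<in> minimal_elements X (\<preceq>)"
    and ex_minimal_le: "x \<in> X \<Longrightarrow> \<exists>p \<in> minimal_elements X (\<preceq>). p \<preceq> x"

text \<open>The scalars range over the class \<^class>\<open>real_normed_field\<close> only so that one definition serves
  both \<open>\<real>\<close> and \<open>\<complex>\<close>; their topology is the usual one, \<^term>\<open>euclidean\<close>.\<close>

locale topological_evs = evs X add smul le theta
  for X :: "'a set"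
    and add :: "'a \<Rightarrow> 'a \<Rightarrow> 'a"  (infixl \<open>\<oplus>\<close> 65)
    and smul :: "'k::real_normed_field \<Rightarrow> 'a \<Rightarrow> 'a"  (infixr \<open>\<odot>\<close> 75)
    and le :: "'a \<Rightarrow> 'a \<Rightarrow> bool"  (infix \<open>\<preceq>\<close> 50)
    and theta :: 'a  (\<open>\<theta>\<close>) +
  fixes T :: "'a topology"
  assumes topspace_eq: "topspace T = X"
    and continuous_add: "continuous_map (prod_topology T T) T (\<lambda>(x, y). x \<oplus> y)"
    and continuous_smul: "continuous_map (prod_topology euclidean T) T (\<lambda>(\<alpha>, x). \<alpha> \<odot> x)"
    and closed_le: "closedin (prod_topology T T) {(x, y). x \<in> X \<and> y \<in> X \<and> x \<preceq> y}"

definition neighbourhood_of :: "'a topology \<Rightarrow> 'a \<Rightarrow> 'a set \<Rightarrow> bool" where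
  "neighbourhood_of T x V \<longleftrightarrow> V \<subseteq> topspace T \<and> (\<exists>U. openin T U \<and> x \<in> U \<and> U \<subseteq> V)"

definition evs_bounded ::
  "('k::real_normed_field \<Rightarrow> 'a \<Rightarrow> 'a) \<Rightarrow> 'a \<Rightarrow> 'a topology \<Rightarrow> 'a set \<Rightarrow> bool" where
  "evs_bounded smul theta T A \<longleftrightarrow> A \<subseteq> topspace T \<and>
     (\<forall>V. neighbourhood_of T theta V \<longrightarrow>
        (\<exists>\<alpha>::real. \<alpha> > 0 \<and> (\<forall>\<mu>::'k. norm \<mu> \<le> \<alpha> \<longrightarrow> smul \<mu> ` A \<subseteq> V)))"

end

theory Submission
  imports Defs
begin

text \<open>Since \<open>0 \<cdot> a = \<theta>\<close> for every \<open>a\<close>, scalar multiplication maps the compact product \<open>{0} \<times> A\<close>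
  into any given open neighbourhood \<open>U\<close> of \<open>\<theta>\<close>. The preimage of \<open>U\<close> under it is open, so by
  Wallace's theorem it contains a whole rectangle \<open>N \<times> M\<close> with \<open>N\<close> an open neighbourhood
  of \<open>0\<close> and \<open>M \<supseteq> A\<close>; a closed ball about \<open>0\<close> inside \<open>N\<close> gives the bound required uniformly on \<open>A\<close>.
  The argument is the same for every normed field of scalars.\<close>

lemma (in topological_evs) compactin_imp_evs_bounded:
  assumes A: "compactin T A"
  shows "evs_bounded smul theta T A"
  unfolding evs_bounded_def
proof (intro conjI allI impI)
  show AT: "A \<subseteq> topspace T"
    using A by (rule compactin_subset_topspace)
  fix V assume "neighbourhood_of T theta V"
  then obtain U where U: "openin T U" "theta \<in> U" "U \<subseteq> V"
    unfolding neighbourhood_of_def by blast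
  define W where "W = {p \<in> topspace (prod_topology euclidean T). (\<lambda>(\<alpha>, x). smul \<alpha> x) p \<in> U}"
  have W: "openin (prod_topology euclidean T) W"
    unfolding W_def using continuous_smul U(1) by (rule openin_continuous_map_preimage)
  have "smul 0 a = theta" if "a \<in> A" for a
    using that AT smul_eq_theta_iff topspace_eq by blast
  then have "{0} \<times> A \<subseteq> W"
    using AT U(2) by (auto simp: W_def)
  then obtain N M where NM: "openin euclidean N" "{0} \<subseteq> N" "A \<subseteq> M" "N \<times> M \<subseteq> W"
    using A W by (auto elim: Wallace_theorem_prod_topology[of euclidean "{0}" T A W, rotated 3])
  then obtain e where e: "e > 0" "cball 0 e \<subseteq> N"
    using open_contains_cball[of N] by auto
  have "smul \<mu> ` A \<subseteq> V" if "norm \<mu> \<le> e" for \<mu>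
  proof -
    have "\<mu> \<in> N"
      using e(2) that by auto
    then have "(\<mu>, a) \<in> W" if "a \<in> A" for a
      using that NM(3,4) by blast
    then show ?thesis
      using U(3) by (auto simp: W_def)
  qed
  then show "\<exists>\<alpha>>0. \<forall>\<mu>. norm \<mu> \<le> \<alpha> \<longrightarrow> smul \<mu> ` A \<subseteq> V"
    using e(1) by blast
qed

theorem mainTheorem4:
  fixes X :: "'a set"
    and add :: "'a \<Rightarrow> 'a \<Rightarrow> 'a"
    and smulR :: "real \<Rightarrow> 'a \<Rightarrow> 'a"
    and smulC :: "complex \<Rightarrow> 'a \<Rightarrow> 'a"
    and le :: "'a \<Rightarrow> 'a \<Rightarrow> bool"
    and theta :: 'a
    and T :: "'a topology"
  shows "(topological_evs X add smulR le theta T \<longrightarrow>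
            (\<forall>A. compactin T A \<longrightarrow> evs_bounded smulR theta T A)) \<and>
         (topological_evs X add smulC le theta T \<longrightarrow>
            (\<forall>A. compactin T A \<longrightarrow> evs_bounded smulC theta T A))"
  by (blast intro: topological_evs.compactin_imp_evs_bounded)

end
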